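(* Let $s\geq 2$, $k=2^s-1$, and let $F$ be a caterpillar with $k$ edges of one of the following forms: (a) $CP_{(1,t,1)}$ with $t\geq 2$; (b) $CP_{(t,q)}$ with $t,q\geq 2$ odd; (c) $CP_{(t,0,q)}$ with $t,q\geq 2$; (d) $CP_{(t,0,0,q)}$ with $t,q\geq 2$; (e) $CP_{(t,1,q)}$ with $t,q\geq 2$ odd. Then $ex^*(n,F)\geq \frac{k}{2}n+O(1)$ as $n\to\infty$.
   Context: The caterpillar $CP_{(s_1,\dots,s_t)}$ is the tree consisting of a central path with $t$ vertices $v_1,\dots,v_t$ (in order) together with $s_i$ pendant leaves attached to $v_i$ for each $i$. An edge coloring is proper if edges sharing a vertex get different colors; a subgraph is rainbow if all its edges have distinct colors. $ex^*(n,F)$ is the maximum number of edges in a properly edge-colored $n$-vertex graph with no rainbow copy of $F$. *)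

theory Defs
  imports Complex_Main "HOL-Library.Landau_Symbols"
begin

datatype 'a graph = Graph (verts: "'a set") (edges: "'a set set")

definition simple_graph :: "'a graph \<Rightarrow> bool" where
  "simple_graph G \<longleftrightarrow> finite (verts G) \<and> (\<forall>e\<in>edges G. e \<subseteq> verts G \<and> card e = 2)"

definition subgraph :: "'a graph \<Rightarrow> 'a graph \<Rightarrow> bool" where
  "subgraph H G \<longleftrightarrow> simple_graph H \<and> verts H \<subseteq> verts G \<and> edges H \<subseteq> edges G"

definition isomorphic :: "'a graph \<Rightarrow> 'b graph \<Rightarrow> bool" where
  "isomorphic F H \<longleftrightarrow>
     (\<exists>f. bij_betw f (verts F) (verts H) \<and> edges H = (\<lambda>e. f ` e) ` edges F)"

definition proper_edge_coloring :: "'a graph \<Rightarrow> ('a set \<Rightarrow> 'c) \<Rightarrow> bool" where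
  "proper_edge_coloring G c \<longleftrightarrow>
     (\<forall>e\<in>edges G. \<forall>e'\<in>edges G. e \<noteq> e' \<and> e \<inter> e' \<noteq> {} \<longrightarrow> c e \<noteq> c e')"

definition rainbow :: "('a set \<Rightarrow> 'c) \<Rightarrow> 'a graph \<Rightarrow> bool" where
  "rainbow c H \<longleftrightarrow> inj_on c (edges H)"

definition has_rainbow_copy :: "'a graph \<Rightarrow> ('a set \<Rightarrow> 'c) \<Rightarrow> 'b graph \<Rightarrow> bool" where
  "has_rainbow_copy G c F \<longleftrightarrow> (\<exists>H. subgraph H G \<and> isomorphic F H \<and> rainbow c H)"

(* Natural numbers suffice as vertices and as colors, since the host graphs are finite.
   The set of sizes is finite; it is nonempty whenever F has an edge. *)
definition ex_star_sizes :: "nat \<Rightarrow> 'b graph \<Rightarrow> nat set" where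
  "ex_star_sizes n F =
     {card (edges G) | (G :: nat graph) (c :: nat set \<Rightarrow> nat).
        simple_graph G \<and> card (verts G) = n \<and> proper_edge_coloring G c
        \<and> \<not> has_rainbow_copy G c F}"

definition ex_star :: "nat \<Rightarrow> 'b graph \<Rightarrow> nat" where
  "ex_star n F = Max (ex_star_sizes n F)"

(* Path vertices are indexed from 0: the i-th path vertex has xs ! i pendant leaves. *)
datatype cat_vertex = Spine nat | Leaf nat nat

definition caterpillar :: "nat list \<Rightarrow> cat_vertex graph" where
  "caterpillar xs = Graph
     ({Spine i | i. i < length xs} \<union> {Leaf i j | i j. i < length xs \<and> j < xs ! i})
     ({{Spine i, Spine (Suc i)} | i. Suc i < length xs} \<union>
      {{Spine i, Leaf i j} | i j. i < length xs \<and> j < xs ! i})"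

lemma finite_ex_star_sizes: "finite (ex_star_sizes n F)"
proof (rule finite_subset)
  show "ex_star_sizes n F \<subseteq> {..2 ^ n}"
  proof
    fix m assume "m \<in> ex_star_sizes n F"
    then obtain G :: "nat graph" where G: "simple_graph G" "card (verts G) = n"
      and m: "m = card (edges G)"
      unfolding ex_star_sizes_def by blast
    have "edges G \<subseteq> Pow (verts G)" "finite (verts G)"
      using G(1) unfolding simple_graph_def by auto
    then have "card (edges G) \<le> card (Pow (verts G))"
      by (intro card_mono) auto
    then show "m \<in> {..2 ^ n}"
      using \<open>finite (verts G)\<close> G(2) m by (simp add: card_Pow)
  qed
qed simp

lemma ex_star_sizes_nonempty:
  assumes "edges F \<noteq> {}"
  shows "ex_star_sizes n F \<noteq> {}"
proof -
  let ?G = "Graph {..<n} {} :: nat graph"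
  have "\<not> has_rainbow_copy ?G (\<lambda>_. 0 :: nat) F"
    using assms unfolding has_rainbow_copy_def subgraph_def isomorphic_def by auto
  then have "card (edges ?G) \<in> ex_star_sizes n F"
    unfolding ex_star_sizes_def
    by (intro CollectI exI[of _ ?G] exI[of _ "\<lambda>_. 0 :: nat"])
       (auto simp: simple_graph_def proper_edge_coloring_def)
  then show ?thesis by blast
qed

lemma simple_graph_caterpillar: "simple_graph (caterpillar xs)"
proof -
  have "{Spine i | i. i < length xs} = Spine ` {..<length xs}" by auto
  moreover have "{Leaf i j | i j. i < length xs \<and> j < xs ! i} =
      (\<Union>i\<in>{..<length xs}. Leaf i ` {..<xs ! i})" by auto
  ultimately show ?thesis
    unfolding simple_graph_def caterpillar_def by (auto simp: card_insert_if)
qed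

end

theory Submission
  imports Defs "HOL-Library.Z2"
begin

text \<open>
  Colour the edge \<open>uv\<close> of the complete graph on \<open>(\<int>/2)\<^sup>s\<close> by \<open>u + v\<close>. A rainbow copy of a tree \<open>F\<close> with
  \<open>2\<^sup>s - 1\<close> edges would be spanning and would use every nonzero colour. As \<open>s \<ge> 2\<close>, both the sum of all
  vertices and the sum of all colours vanish, and the latter is the sum of \<open>deg v * v\<close>. Hence the
  vertices of even degree add up to zero. For each of the given caterpillars these are two distinct
  vertices or the endpoints of two edges of different colours, which is impossible. Disjoint copies of
  this coloured complete graph give the bound.
\<close>

section \<open>Binary digits over the two-element field\<close>

unbundle bit_operations_syntax

text \<open>Values lie in the field \<open>bit\<close>, so that XOR becomes addition and sums of
  vertices can be taken digit by digit.\<close>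

definition bit2 :: "nat \<Rightarrow> nat \<Rightarrow> bit" where
  "bit2 i x = of_bool (bit x i)"

lemma bit2_xor: "bit2 i (x XOR y) = bit2 i x + bit2 i y"
  by (auto simp: bit2_def bit_xor_iff)

lemma bit2_eqI: "(\<And>i. bit2 i x = bit2 i y) \<Longrightarrow> x = y"
  by (rule bit_eqI) (simp add: bit2_def of_bool_eq_iff)

text \<open>In each run of four starting at a multiple of 4, digits 0 and 1 are set twice each and
  every higher digit is constant, so everything cancels.\<close>

lemma sum_bit2_lessThan: "(\<Sum>x<4 * m. bit2 i x) = 0"
proof (induction m)
  case (Suc m)
  have "bit2 i (4 * m) + bit2 i (4 * m + 1) + bit2 i (4 * m + 2) + bit2 i (4 * m + 3) = 0"
  proof -
    consider "i = 0" | "i = 1" | j where "i = j + 2"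
      by (metis One_nat_def add_2_eq_Suc' not0_implies_Suc)
    then show ?thesis
    proof cases
      case 3
      have "bit2 i (4 * m + r) = bit2 j m" if "r < 4" for r
      proof -
        have "(4 * m + r) div 2 ^ i = (4 * m + r) div 4 div 2 ^ j"
          using 3 by (simp add: div_mult2_eq power_add mult.commute)
        then show ?thesis
          using that by (simp add: bit2_def bit_iff_odd)
      qed
      from this[of 0] this[of 1] this[of 2] this[of 3] show ?thesis
        by (simp add: add.assoc)
    next
      case 2
      have "odd ((4 * m + 3) div 2)"
        by presburger
      with 2 show ?thesis
        by (simp add: bit2_def bit_iff_odd)
    qed (simp add: bit2_def bit_iff_odd)
  qed
  moreover have "4 * Suc m = Suc (Suc (Suc (Suc (4 * m))))"
    by simp
  ultimately show ?case
    using Suc by (simp add: eval_nat_numeral add.assoc)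
qed simp

text \<open>The block is the difference of two initial segments whose lengths are multiples of
  4.\<close>

lemma sum_bit2_block:
  assumes "4 dvd N"
  shows "(\<Sum>x\<in>{b * N..<Suc b * N}. bit2 i x) = 0"
proof -
  obtain M where M: "N = 4 * M"
    using assms by auto
  have "(\<Sum>x<Suc b * N. bit2 i x) = (\<Sum>x<b * N. bit2 i x) + (\<Sum>x\<in>{b * N..<Suc b * N}. bit2 i x)"
    unfolding lessThan_atLeast0 by (rule sum.atLeastLessThan_concat[symmetric]) auto
  moreover have "(\<Sum>x<a * N. bit2 i x) = 0" for a
    using sum_bit2_lessThan[of i "a * M"] by (simp add: M mult.left_commute)
  ultimately show ?thesis
    by (metis add_0)
qed

text \<open>The digits from position \<open>s\<close> on agree, so XOR clears them.\<close>

lemma xor_less_power: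
  fixes u v :: nat
  assumes "u div 2 ^ s = v div 2 ^ s"
  shows "u XOR v < 2 ^ s"
proof -
  have "drop_bit s (u XOR v) = 0"
    using assms by (simp add: drop_bit_xor flip: drop_bit_eq_div)
  then show ?thesis
    by (simp add: drop_bit_eq_div div_eq_0_iff)
qed

lemma xor_left_cancel_nat: "u XOR v = u XOR w \<longleftrightarrow> v = w" for u v w :: nat
  by (metis xor.assoc xor.left_neutral xor_self_eq)

section \<open>The XOR colouring on disjoint cliques\<close>

definition xor_color :: "nat set \<Rightarrow> nat" where
  "xor_color e = Min e XOR Max e"

text \<open>\<open>Min\<close> and \<open>Max\<close> merely order the ends of an edge; XOR
  commutes, so the order is immaterial.\<close>

lemma xor_color_doubleton: "xor_color {u, v} = u XOR v"
  by (auto simp: xor_color_def min_def max_def xor.commute)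

text \<open>For \<open>N = 2 ^ s\<close> the numbers in a block share all digits from position
  \<open>s\<close> on, so each block is a copy of the group on \<open>s\<close> bits. The last
  \<open>n mod N\<close> vertices stay isolated.\<close>

definition cliques :: "nat \<Rightarrow> nat \<Rightarrow> nat graph" where
  "cliques N n = Graph {..<n} {e. card e = 2 \<and> (\<exists>b<n div N. e \<subseteq> {b * N..<Suc b * N})}"

lemma cliques_sel:
  "verts (cliques N n) = {..<n}"
  "edges (cliques N n) = (\<Union>b<n div N. {e. e \<subseteq> {b * N..<Suc b * N} \<and> card e = 2})"
  by (auto simp: cliques_def)

lemma simple_graph_cliques: "simple_graph (cliques N n)"
proof -
  have "Suc b * N \<le> n" if "b < n div N" for b
    using that by (metis Suc_leI div_times_less_eq_dividend le_trans mult_le_mono1)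
  then show ?thesis
    unfolding simple_graph_def cliques_sel by fastforce
qed

lemma div_block: "x \<in> {b * N..<Suc b * N} \<Longrightarrow> x div N = b"
  by (intro div_nat_eqI) (simp_all add: mult.commute[of N])

lemma card_edges_cliques: "card (edges (cliques N n)) = n div N * (N choose 2)"
proof -
  let ?E = "\<lambda>b. {e. e \<subseteq> {b * N..<Suc b * N} \<and> card e = 2}"
  have "?E b \<inter> ?E b' = {}" if "b \<noteq> b'" for b b'
  proof (rule equals0I)
    fix e assume e: "e \<in> ?E b \<inter> ?E b'"
    then obtain x where "x \<in> e"
      by fastforce
    then have "x div N = b" "x div N = b'"
      using e by (blast intro: div_block)+
    then show False
      using that by simp
  qed
  moreover have "card (?E b) = N choose 2" for b
    by (subst n_subsets) auto
  moreover have "finite (?E b)" for b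
    by (rule finite_subset[of _ "Pow {b * N..<Suc b * N}"]) auto
  ultimately show ?thesis
    unfolding cliques_sel by (subst card_UN_disjoint) auto
qed

lemma cliques_edge_div:
  assumes "{u, v} \<in> edges (cliques N n)"
  shows "u div N = v div N"
proof -
  obtain b where "u \<in> {b * N..<Suc b * N}" "v \<in> {b * N..<Suc b * N}"
    using assms unfolding cliques_sel by auto
  then have "u div N = b" "v div N = b"
    by (auto intro: div_block simp del: mult_Suc)
  then show ?thesis
    by simp
qed

text \<open>XOR with the shared vertex is injective.\<close>

lemma proper_xor_color:
  assumes "simple_graph G"
  shows "proper_edge_coloring G xor_color"
  unfolding proper_edge_coloring_def
proof (intro ballI impI)
  fix e e'
  assume "e \<in> edges G" "e' \<in> edges G" "e \<noteq> e' \<and> e \<inter> e' \<noteq> {}"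
  then obtain u where "card e = 2" "card e' = 2" "u \<in> e" "u \<in> e'"
    using assms by (auto simp: simple_graph_def)
  then obtain v w where "e = {u, v}" "e' = {u, w}"
    by (metis card_2_iff insert_commute insertE singletonD)
  then show "xor_color e \<noteq> xor_color e'"
    using \<open>e \<noteq> e' \<and> _\<close> by (auto simp: xor_color_doubleton xor_left_cancel_nat)
qed

section \<open>Sums over a caterpillar and its connectedness\<close>

lemma sum_edges_caterpillar:
  "sum g (edges (caterpillar xs)) =
     (\<Sum>i<length xs - 1. g {Spine i, Spine (Suc i)}) +
     (\<Sum>i<length xs. \<Sum>j<xs ! i. g {Spine i, Leaf i j})"
proof -
  let ?A = "(\<lambda>i. {Spine i, Spine (Suc i)}) ` {..<length xs - 1}"
  let ?I = "Sigma {..<length xs} (\<lambda>i. {..<xs ! i})"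
  let ?B = "(\<lambda>(i, j). {Spine i, Leaf i j}) ` ?I"
  have "edges (caterpillar xs) = ?A \<union> ?B"
    by (auto simp: caterpillar_def less_diff_conv image_iff)
  moreover have "?A \<inter> ?B = {}"
    by (auto simp: doubleton_eq_iff)
  ultimately have "sum g (edges (caterpillar xs)) = sum g ?A + sum g ?B"
    by (simp add: sum.union_disjoint)
  also have "sum g ?A = (\<Sum>i<length xs - 1. g {Spine i, Spine (Suc i)})"
    by (subst sum.reindex) (auto simp: inj_on_def doubleton_eq_iff)
  also have "sum g ?B = (\<Sum>(i, j)\<in>?I. g {Spine i, Leaf i j})"
    by (subst sum.reindex) (auto simp: inj_on_def doubleton_eq_iff intro!: sum.cong)
  also have "\<dots> = (\<Sum>i<length xs. \<Sum>j<xs ! i. g {Spine i, Leaf i j})"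
    by (subst sum.Sigma) auto
  finally show ?thesis .
qed

text \<open>As for edges, \<open>g\<close> stays arbitrary: the constant 1 yields the counts, and
  digits yield the identity for rainbow copies.\<close>

lemma sum_verts_caterpillar:
  "sum g (verts (caterpillar xs)) =
     (\<Sum>i<length xs. g (Spine i)) + (\<Sum>i<length xs. \<Sum>j<xs ! i. g (Leaf i j))"
proof -
  let ?A = "Spine ` {..<length xs}"
  let ?I = "Sigma {..<length xs} (\<lambda>i. {..<xs ! i})"
  let ?B = "(\<lambda>(i, j). Leaf i j) ` ?I"
  have "verts (caterpillar xs) = ?A \<union> ?B"
    by (auto simp: caterpillar_def image_iff)
  moreover have "?A \<inter> ?B = {}"
    by auto
  ultimately have "sum g (verts (caterpillar xs)) = sum g ?A + sum g ?B"
    by (simp add: sum.union_disjoint)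
  also have "sum g ?A = (\<Sum>i<length xs. g (Spine i))"
    by (subst sum.reindex) (auto simp: inj_on_def)
  also have "sum g ?B = (\<Sum>(i, j)\<in>?I. g (Leaf i j))"
    by (subst sum.reindex) (auto simp: inj_on_def intro!: sum.cong)
  also have "\<dots> = (\<Sum>i<length xs. \<Sum>j<xs ! i. g (Leaf i j))"
    by (subst sum.Sigma) auto
  finally show ?thesis .
qed

lemma card_edges_caterpillar:
  "card (edges (caterpillar xs)) = length xs - 1 + (\<Sum>i<length xs. xs ! i)"
  using sum_edges_caterpillar[of "\<lambda>_. 1 :: nat" xs] by simp

lemma card_verts_caterpillar:
  "card (verts (caterpillar xs)) = length xs + (\<Sum>i<length xs. xs ! i)"
  using sum_verts_caterpillar[of "\<lambda>_. 1 :: nat" xs] by simp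

text \<open>This is connectedness, by induction along the spine and then out to the leaves. It will
  confine a copy to a single block.\<close>

lemma caterpillar_const:
  assumes edge: "\<And>u v. {u, v} \<in> edges (caterpillar xs) \<Longrightarrow> h u = h v"
    and v: "v \<in> verts (caterpillar xs)"
  shows "h v = h (Spine 0)"
proof -
  have spine: "h (Spine i) = h (Spine 0)" if "i < length xs" for i
    using that
  proof (induction i)
    case (Suc i)
    then have "h (Spine i) = h (Spine (Suc i))"
      by (intro edge) (auto simp: caterpillar_def)
    with Suc show ?case
      by simp
  qed simp
  have "h (Spine i) = h (Leaf i j)" if "i < length xs" "j < xs ! i" for i j
    using that by (intro edge) (auto simp: caterpillar_def)
  with spine show ?thesis
    using v by (fastforce simp: caterpillar_def)
qed

section \<open>Rainbow caterpillars inside the cliques\<close>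

text \<open>
  The bitwise form of the statement that the vertices of even degree add up to zero: \<open>Spine i\<close> occurs
  \<open>xs ! i\<close> times in the leaf edges and once in the sum of all vertices, while each leaf cancels.
\<close>

lemma rainbow_caterpillar_spine:
  fixes xs :: "nat list" and f :: "cat_vertex \<Rightarrow> nat"
  defines "F \<equiv> caterpillar xs"
  assumes s: "s \<ge> 2" and xs: "xs \<noteq> []"
    and card: "card (edges F) = 2 ^ s - 1"
    and inj: "inj_on f (verts F)"
    and sub: "(`) f ` edges F \<subseteq> edges (cliques (2 ^ s) n)"
    and rb: "inj_on xor_color ((`) f ` edges F)"
  shows "(\<Sum>i<length xs. (of_nat (xs ! i) + 1) * bit2 d (f (Spine i))) +
         (\<Sum>i<length xs - 1. bit2 d (f (Spine i)) + bit2 d (f (Spine (Suc i)))) = 0"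
proof -
  let ?N = "2 ^ s :: nat"
  let ?p = "\<lambda>v. bit2 d (f v)"
  let ?c = "\<lambda>e. xor_color (f ` e)"
  define b where "b = f (Spine 0) div ?N"
  have dvd: "4 dvd ?N"
    using s le_imp_power_dvd[of 2 s "2 :: nat"] by simp
  have edge: "f u div ?N = f v div ?N" if "{u, v} \<in> edges F" for u v
    using that sub by (intro cliques_edge_div[where n = n]) auto
  have edgeF: "\<And>e. e \<in> edges F \<Longrightarrow> e \<subseteq> verts F \<and> card e = 2"
    using simple_graph_caterpillar[of xs] by (auto simp: F_def simple_graph_def)

  \<comment> \<open>A tree has one vertex more than edges, so the copy has \<open>2 ^ s\<close>
    vertices and fills its whole block.\<close>
  have "card (verts F) = card (edges F) + 1"
    using xs by (cases xs) (simp_all add: F_def card_edges_caterpillar card_verts_caterpillar)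
  then have "card (verts F) = ?N"
    by (simp add: card)
  moreover have "f ` verts F \<subseteq> {b * ?N..<Suc b * ?N}"
  proof
    fix y assume "y \<in> f ` verts F"
    then have "y div ?N = b"
      using caterpillar_const[of xs "\<lambda>v. f v div ?N"] edge unfolding F_def b_def by blast
    then show "y \<in> {b * ?N..<Suc b * ?N}"
      using dividend_less_div_times[of ?N y] by auto
  qed
  ultimately have "f ` verts F = {b * ?N..<Suc b * ?N}"
    by (intro card_subset_eq) (auto simp: card_image[OF inj])
  then have verts0: "sum ?p (verts F) = 0"
    using sum_bit2_block[OF dvd, of d b] sum.reindex[OF inj, of "bit2 d"] by (simp add: o_def)

  have injF: "inj_on ((`) f) (edges F)"
    using inj edgeF by (meson inj_onI inj_on_image_eq_iff)
  then have injc: "inj_on ?c (edges F)"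
    using comp_inj_on[OF _ rb] by (simp add: o_def)
  \<comment> \<open>Colours are nonzero, as the ends differ, and below \<open>2 ^ s\<close>, as the
    ends share a block. With \<open>2 ^ s - 1\<close> edges, each such colour occurs exactly
    once.\<close>
  have "?c ` edges F \<subseteq> {1..<?N}"
  proof
    fix y assume "y \<in> ?c ` edges F"
    then obtain e where e: "e \<in> edges F" "y = ?c e"
      by auto
    then obtain u v where uv: "e = {u, v}" "u \<noteq> v"
      using edgeF by (meson card_2_iff)
    have "f u \<noteq> f v"
      using uv e edgeF inj by (metis inj_on_eq_iff insert_subset)
    then have "f u XOR f v \<noteq> 0"
      using xor_left_cancel_nat[of "f u" "f u" "f v"] by auto
    moreover have "f u XOR f v < ?N"
      using e uv by (intro xor_less_power edge) auto
    ultimately show "y \<in> {1..<?N}"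
      using e uv by (simp add: xor_color_doubleton)
  qed
  then have "?c ` edges F = {1..<?N}"
    by (intro card_subset_eq) (auto simp: card_image[OF injc] card)
  then have "(\<Sum>e\<in>edges F. bit2 d (?c e)) = (\<Sum>x\<in>{1..<?N}. bit2 d x)"
    using sum.reindex[OF injc, of "bit2 d"] by (simp add: o_def)
  \<comment> \<open>Colour 0 adds nothing and completes the range to block 0.\<close>
  also have "\<dots> = (\<Sum>x\<in>{0 * ?N..<Suc 0 * ?N}. bit2 d x)"
    by (rule sum.mono_neutral_left) (auto simp: bit2_def not_le)
  also have "\<dots> = 0"
    by (rule sum_bit2_block[OF dvd])
  \<comment> \<open>Adding the vertex sum makes each leaf appear twice, once from its edge and once
    as a vertex, so \<open>?L\<close> will cancel.\<close>
  finally have "(\<Sum>e\<in>edges F. bit2 d (?c e)) + sum ?p (verts F) = 0"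
    by (simp add: verts0)
  then have sum0: "(\<Sum>i<length xs - 1. ?p (Spine i) + ?p (Spine (Suc i))) +
      (\<Sum>i<length xs. \<Sum>j<xs ! i. ?p (Spine i) + ?p (Leaf i j)) +
      ((\<Sum>i<length xs. ?p (Spine i)) + (\<Sum>i<length xs. \<Sum>j<xs ! i. ?p (Leaf i j))) = 0"
    (is "?S + ?B + (?C + ?L) = 0")
    unfolding F_def sum_edges_caterpillar sum_verts_caterpillar
    by (simp only: image_insert image_empty xor_color_doubleton bit2_xor)
  have "?B = (\<Sum>i<length xs. of_nat (xs ! i) * ?p (Spine i)) + ?L"
    by (simp only: sum.distrib sum_constant card_lessThan)
  then have "?S + ?B + (?C + ?L) =
      ((\<Sum>i<length xs. of_nat (xs ! i) * ?p (Spine i)) + ?C + ?S) + (?L + ?L)"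
    by (simp only: ac_simps)
  moreover have "?L + ?L = 0"
    by (cases ?L) simp_all
  ultimately show ?thesis
    using sum0 by (simp only: distrib_right sum.distrib mult_1 add_0_right)
qed

text \<open>In the identity, \<open>f (Spine i)\<close> has coefficient degree plus 1 modulo 2, so
  exactly the spine vertices of even degree survive; two surviving bits with sum zero agree. Where
  the shape leaves parities open, the odd number of edges restricts them.\<close>

lemma no_rainbow_caterpillar:
  fixes F :: "cat_vertex graph"
  assumes s: "s \<ge> 2" and card: "card (edges F) = 2 ^ s - 1"
    and F: "(\<exists>t\<ge>2. F = caterpillar [1, t, 1])
       \<or> (\<exists>t\<ge>2. \<exists>q\<ge>2. odd t \<and> odd q \<and> F = caterpillar [t, q])
       \<or> (\<exists>t\<ge>2. \<exists>q\<ge>2. F = caterpillar [t, 0, q])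
       \<or> (\<exists>t\<ge>2. \<exists>q\<ge>2. F = caterpillar [t, 0, 0, q])
       \<or> (\<exists>t\<ge>2. \<exists>q\<ge>2. odd t \<and> odd q \<and> F = caterpillar [t, 1, q])"
  shows "\<not> has_rainbow_copy (cliques (2 ^ s) n) xor_color F"
proof
  assume "has_rainbow_copy (cliques (2 ^ s) n) xor_color F"
  then obtain H f where H: "edges H \<subseteq> edges (cliques (2 ^ s) n)" "inj_on xor_color (edges H)"
    and f: "bij_betw f (verts F) (verts H)" "edges H = (`) f ` edges F"
    unfolding has_rainbow_copy_def subgraph_def isomorphic_def rainbow_def by auto
  have inj: "inj_on f (verts F)"
    using f by (simp add: bij_betw_def)
  have key: "(\<Sum>i<length xs. (of_nat (xs ! i) + 1) * bit2 d (f (Spine i))) +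
      (\<Sum>i<length xs - 1. bit2 d (f (Spine i)) + bit2 d (f (Spine (Suc i)))) = 0"
    if "F = caterpillar xs" "xs \<noteq> []" for xs d
    using rainbow_caterpillar_spine[of s xs f n d] s card inj H f that by simp
  have spine: "f (Spine i) \<noteq> f (Spine j)"
    if "F = caterpillar xs" "i < length xs" "j < length xs" "i \<noteq> j" for xs i j
    using inj that by (auto simp: caterpillar_def inj_on_eq_iff)
  have parity: "odd (length xs - 1 + (\<Sum>i<length xs. xs ! i))" if "F = caterpillar xs" for xs
  proof -
    have "odd (2 ^ s - 1 :: nat)"
      using s by simp
    then show ?thesis
      using that card card_edges_caterpillar[of xs] by metis
  qed
  have of_nat_bit: "(of_nat t :: bit) = of_bool (odd t)" for t
    by (induction t) auto
  note S = eval_nat_numeral of_nat_bit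
  from F show False
  proof (elim disjE exE conjE)
    fix t assume F: "F = caterpillar [1, t, 1]"
    \<comment> \<open>There are \<open>t + 4\<close> edges. The centre has odd degree
      \<open>t + 2\<close>, which leaves the two ends of degree 2.\<close>
    have "odd t"
      using parity[OF F] by simp
    then have "bit2 d (f (Spine 0)) = bit2 d (f (Spine 2))" for d
      using key[OF F, of d] by (auto simp: S; metis bit_not_zero_iff zero_neq_one)
    then have "f (Spine 0) = f (Spine 2)"
      by (rule bit2_eqI)
    then show False
      using spine[OF F, of 0 2] by simp
  next
    fix t q assume "odd t" "odd q" and F: "F = caterpillar [t, q]"
    then have "bit2 d (f (Spine 0)) = bit2 d (f (Spine 1))" for d
      using key[OF F, of d] by (auto simp: S; metis bit_not_zero_iff zero_neq_one)
    then have "f (Spine 0) = f (Spine 1)"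
      by (rule bit2_eqI)
    then show False
      using spine[OF F, of 0 1] by simp
  next
    fix t q assume F: "F = caterpillar [t, 0, q]"
    \<comment> \<open>As \<open>t + q + 2\<close> is odd, the middle vertex of degree 2 survives
      together with exactly one end.\<close>
    consider "odd t" "even q" | "even t" "odd q"
      using parity[OF F] by auto
    then show False
    proof cases
      case 1
      then have "bit2 d (f (Spine 0)) = bit2 d (f (Spine 1))" for d
        using key[OF F, of d] by (auto simp: S; metis bit_not_zero_iff zero_neq_one)
      then have "f (Spine 0) = f (Spine 1)"
        by (rule bit2_eqI)
      then show False
        using spine[OF F, of 0 1] by simp
    next
      case 2
      then have "bit2 d (f (Spine 1)) = bit2 d (f (Spine 2))" for d
        using key[OF F, of d] by (auto simp: S; metis bit_not_zero_iff zero_neq_one)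
      then have "f (Spine 1) = f (Spine 2)"
        by (rule bit2_eqI)
      then show False
        using spine[OF F, of 1 2] by simp
    qed
  next
    fix t q assume F: "F = caterpillar [t, 0, 0, q]"
    \<comment> \<open>As \<open>t + q + 3\<close> is odd, the two ends have equal parity: either
      only the two middle vertices survive or all four do.\<close>
    consider "even t" "even q" | "odd t" "odd q"
      using parity[OF F] by auto
    then show False
    proof cases
      case 1
      then have "bit2 d (f (Spine 1)) = bit2 d (f (Spine 2))" for d
        using key[OF F, of d] by (auto simp: S; metis bit_not_zero_iff zero_neq_one)
      then have "f (Spine 1) = f (Spine 2)"
        by (rule bit2_eqI)
      then show False
        using spine[OF F, of 1 2] by simp
    next
      case 2
      \<comment> \<open>Four survivors are paired into the first and last spine edges, which then
        share a colour and contradict rainbowness.\<close>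
      then have "bit2 d (f (Spine 0) XOR f (Spine 1)) = bit2 d (f (Spine 2) XOR f (Spine 3))" for d
        using key[OF F, of d] by (auto simp: S bit2_xor; metis bit_not_zero_iff zero_neq_one)
      then have "xor_color (f ` {Spine 0, Spine 1}) = xor_color (f ` {Spine 2, Spine 3})"
        unfolding image_insert image_empty xor_color_doubleton by (rule bit2_eqI)
      moreover have "f ` {Spine 0, Spine 1} \<in> edges H" "f ` {Spine 2, Spine 3} \<in> edges H"
        unfolding f(2) F by (rule imageI, force simp: caterpillar_def)+
      ultimately have "f ` {Spine 0, Spine 1} = f ` {Spine 2, Spine 3}"
        using H(2) by (meson inj_onD)
      then show False
        using spine[OF F, of 0 2] spine[OF F, of 0 3] by (auto simp: doubleton_eq_iff)
    qed
  next
    fix t q assume "odd t" "odd q" and F: "F = caterpillar [t, 1, q]"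
    then have "bit2 d (f (Spine 0)) = bit2 d (f (Spine 2))" for d
      using key[OF F, of d] by (auto simp: S; metis bit_not_zero_iff zero_neq_one)
    then have "f (Spine 0) = f (Spine 2)"
      by (rule bit2_eqI)
    then show False
      using spine[OF F, of 0 2] by simp
  qed
qed

section \<open>The lower bound on \<open>ex_star\<close>\<close>

theorem theorem4p3:
  fixes s k :: nat and F :: "cat_vertex graph"
  assumes "s \<ge> 2"
    and "k = 2 ^ s - 1"
    and "card (edges F) = k"
    and "(\<exists>t\<ge>2. F = caterpillar [1, t, 1])
       \<or> (\<exists>t\<ge>2. \<exists>q\<ge>2. odd t \<and> odd q \<and> F = caterpillar [t, q])
       \<or> (\<exists>t\<ge>2. \<exists>q\<ge>2. F = caterpillar [t, 0, q])
       \<or> (\<exists>t\<ge>2. \<exists>q\<ge>2. F = caterpillar [t, 0, 0, q])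
       \<or> (\<exists>t\<ge>2. \<exists>q\<ge>2. odd t \<and> odd q \<and> F = caterpillar [t, 1, q])"
  shows "\<exists>g :: nat \<Rightarrow> real. g \<in> O(\<lambda>_. 1) \<and>
           (\<forall>n. real (ex_star n F) \<ge> real k / 2 * real n + g n)"
\<comment> \<open>Fewer than \<open>2 ^ s\<close> vertices lie outside the cliques, and each costs
  at most \<open>k / 2\<close> edges in the bound.\<close>
proof (intro exI[of _ "\<lambda>_. - (real k / 2 * 2 ^ s)"] conjI allI)
  fix n
  let ?N = "2 ^ s :: nat"
  have "card (edges (cliques ?N n)) \<in> ex_star_sizes n F"
    unfolding ex_star_sizes_def
    using simple_graph_cliques[of ?N n] proper_xor_color[OF simple_graph_cliques]
      no_rainbow_caterpillar[of s F n] assms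
    by (intro CollectI exI[of _ "cliques ?N n"] exI[of _ xor_color]) (auto simp: cliques_sel)
  then have le: "n div ?N * (?N choose 2) \<le> ex_star n F"
    unfolding ex_star_def card_edges_cliques[symmetric] by (intro Max_ge finite_ex_star_sizes)
  \<comment> \<open>A clique on \<open>2 ^ s\<close> vertices is \<open>k\<close>-regular, so it has
    \<open>k / 2\<close> edges per vertex.\<close>
  have choose: "real (?N choose 2) = real k / 2 * real ?N"
  proof -
    have "even (?N * (?N - 1))"
      by auto
    then have "2 * (?N choose 2) = ?N * k"
      unfolding choose_two assms(2) by (rule dvd_mult_div_cancel)
    then have "2 * real (?N choose 2) = real ?N * real k"
      by (metis of_nat_mult of_nat_numeral)
    then show ?thesis
      by (simp add: mult.commute)
  qed
  have "real n \<le> real (n div ?N) * real ?N + real ?N"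
    using div_mult_mod_eq[of n ?N] mod_less_divisor[of ?N n]
    by (metis add_left_mono less_imp_le of_nat_add of_nat_le_iff of_nat_mult pos2 zero_less_power)
  then have "real k / 2 * real n \<le> real k / 2 * (real (n div ?N) * real ?N + real ?N)"
    by (intro mult_left_mono) auto
  also have "\<dots> = real (n div ?N * (?N choose 2)) + real k / 2 * 2 ^ s"
    by (simp only: of_nat_mult choose) (simp add: algebra_simps)
  finally show "real k / 2 * real n + - (real k / 2 * 2 ^ s) \<le> real (ex_star n F)"
    using le by linarith
qed simp

end
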